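(* Let $\{g_d(n)\}_{d,n\ge 1}$ be a double sequence in $\mathbb{D}$ (defined in the context), and let $n\ge 6$ be an integer. For $x\in\mathbb{R}$ put $$\Delta_n^{g_d}(x)=\left(P_n^{g_d}(x)\right)^2-P_{n-1}^{g_d}(x)\,P_{n+1}^{g_d}(x).$$ Say that the Turán inequality holds at $(n,x,d)$ if $\Delta_n^{g_d}(x)\ge 0$. \begin{itemize} \item[a)] Let $0\le x<2-\frac{12}{n+4}$. Then $\Delta_n^{g_d}(x)\ge 0$ holds for all but finitely many $d\in\mathbb{N}$ if and only if $n$ is divisible by $3$. \item[b)] Let $n\not\equiv 2\pmod 3$ and $x\ge 0$. Then $\Delta_n^{g_d}(x)\ge 0$ holds for all but finitely many $d\in\mathbb{N}$ if and only if $n$ is divisible by $3$. \end{itemize}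
   Context: $\mathbb{D}$ denotes the set of all double sequences $\{g_d(n)\}_{d,n\ge1}$ of real numbers with $g_d(1)=1$ for all $d$, such that (for each $d$) the power series $\sum_{n\ge1} g_d(n)q^{n-1}$ is regular at $q=0$ (has positive radius of convergence $R$), and such that for all $d,n\ge 1$ $$0\le g_d(n)-n^d\le g_1(n)\,(n-1)^{d-1}.$$ For each $d$, the polynomials $P_n^{g_d}(x)$ are defined by $P_0^{g_d}(x)=1$ and, for $n\ge1$, $$P_n^{g_d}(x)=\frac{x}{n}\sum_{k=1}^n g_d(k)\,P_{n-k}^{g_d}(x);$$ equivalently $\sum_{n\ge0}P_n^{g_d}(x)q^n=\exp\!\left(x\sum_{n\ge1}g_d(n)\frac{q^n}{n}\right)$.
   Formalization: Both equivalences are proved for x > 0 only; at x = 0 they fail when 3 does not divide n, since P_m(0) = 0 for m ≥ 1 gives Δ_n(0) = 0 for all d, and the formal theorem states instead that the Turán inequality holds at x = 0 for all but finitely many d. *)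

theory Defs
  imports "HOL-Analysis.Analysis"
begin

text \<open>Double sequences are encoded as \<open>g d n\<close>; all values with \<open>d = 0\<close> or \<open>n = 0\<close> are
  junk and are neither constrained nor used below.\<close>

definition double_seqs :: "(nat \<Rightarrow> nat \<Rightarrow> real) set" where
  "double_seqs = {g.
     (\<forall>d\<ge>1. g d 1 = 1) \<and>
     (\<forall>d\<ge>1. conv_radius (\<lambda>n. g d (n + 1)) > 0) \<and>
     (\<forall>d\<ge>1. \<forall>n\<ge>1. 0 \<le> g d n - real n ^ d \<and>
        g d n - real n ^ d \<le> g 1 n * (real n - 1) ^ (d - 1))}"

fun P :: "(nat \<Rightarrow> real) \<Rightarrow> nat \<Rightarrow> real \<Rightarrow> real" where
  "P h 0 x = 1"
| "P h (Suc n) x = x / real (Suc n) * (\<Sum>k = 1..Suc n. h k * P h (Suc n - k) x)"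

definition turan_diff :: "(nat \<Rightarrow> real) \<Rightarrow> nat \<Rightarrow> real \<Rightarrow> real" where
  "turan_diff h n x = (P h n x)\<^sup>2 - P h (n - 1) x * P h (n + 1) x"

definition turan_holds :: "(nat \<Rightarrow> nat \<Rightarrow> real) \<Rightarrow> nat \<Rightarrow> real \<Rightarrow> nat \<Rightarrow> bool" where
  "turan_holds g n x d \<longleftrightarrow> turan_diff (g d) n x \<ge> 0"

definition turan_almost_all :: "(nat \<Rightarrow> nat \<Rightarrow> real) \<Rightarrow> nat \<Rightarrow> real \<Rightarrow> bool" where
  "turan_almost_all g n x \<longleftrightarrow> finite {d. d \<ge> 1 \<and> \<not> turan_holds g n x d}"

end

theory Submission
  imports Defs
begin

text \<open>Expanding the recursion writes \<open>P\<^sub>n(x)\<close> as a sum over partitions of \<open>n\<close>, the partition with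
  parts \<open>\<lambda>\<^sub>i\<close> contributing a multiple of \<open>\<Prod> g\<^sub>d(\<lambda>\<^sub>i)\<close>, which behaves like \<open>(\<Prod> \<lambda>\<^sub>i)^d\<close> as
  \<open>d \<rightarrow> \<infinity>\<close>. So \<open>P\<^sub>n(x) / A\<^sub>n^d\<close> converges to an explicit limit \<open>L\<^sub>n(x)\<close>, where \<open>A\<^sub>n\<close> is the largest
  product of the parts of a partition of \<open>n\<close>: parts \<open>3\<close> only if \<open>3\<close> divides \<open>n\<close>; one extra part \<open>2\<close> if
  \<open>n \<equiv> 2\<close>; an extra \<open>4\<close> or \<open>2 + 2\<close> if \<open>n \<equiv> 1\<close>. Comparing \<open>A\<^sub>n\<^sup>2\<close> with \<open>A\<^sub>n\<^sub>-\<^sub>1 A\<^sub>n\<^sub>+\<^sub>1\<close> gives ratios \<open>9 : 8\<close>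
  and \<open>16 : 18\<close> for \<open>n \<equiv> 0, 1\<close>. For \<open>n = 3 m + 2\<close> there is a tie, and the sign is that of
  \<open>L\<^sub>n\<^sup>2 - L\<^sub>n\<^sub>-\<^sub>1 L\<^sub>n\<^sub>+\<^sub>1\<close>, which changes at \<open>x = 2 m / (m + 2) = 2 - 12 / (n + 4)\<close>.\<close>

section \<open>Maximal products of parts and limit coefficients\<close>

text \<open>The value at 1 is set apart because truncated subtraction would make the last branch
  yield 4 there.\<close>

definition max_part_prod :: "nat \<Rightarrow> nat" where
  "max_part_prod n =
     (if n = 1 then 1
      else if n mod 3 = 0 then 3 ^ (n div 3)
      else if n mod 3 = 2 then 2 * 3 ^ (n div 3)
      else 4 * 3 ^ (n div 3 - 1))"

text \<open>In the exponential formula a part \<open>k\<close> of multiplicity \<open>a\<close>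
  contributes \<open>(x / k) ^ a / fact a\<close>; only optimal partitions are kept. The summands
  \<open>x / 4\<close> and \<open>x\<^sup>2 / 8\<close> come from one part 4 and from two parts
  2.\<close>

definition lead_coeff_lim :: "real \<Rightarrow> nat \<Rightarrow> real" where
  "lead_coeff_lim x n =
     (if n = 1 then x
      else if n mod 3 = 0 then (x / 3) ^ (n div 3) / fact (n div 3)
      else if n mod 3 = 2 then x / 2 * (x / 3) ^ (n div 3) / fact (n div 3)
      else (x / 4 + x\<^sup>2 / 8) * (x / 3) ^ (n div 3 - 1) / fact (n div 3 - 1))"

lemma mod_div_3:
  fixes m :: nat
  shows "(3 * m) mod 3 = 0" "(3 * m) div 3 = m"
    "(3 * m + 2) mod 3 = 2" "(3 * m + 2) div 3 = m"
    "(3 * m + 4) mod 3 = 1" "(3 * m + 4) div 3 = Suc m"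
  by presburger+

lemma max_part_prod_simps:
  "max_part_prod 1 = 1"
  "max_part_prod (3 * m) = 3 ^ m"
  "max_part_prod (3 * m + 2) = 2 * 3 ^ m"
  "max_part_prod (3 * m + 4) = 4 * 3 ^ m"
proof -
  have "3 * m \<noteq> 1" by presburger
  then show "max_part_prod 1 = 1" "max_part_prod (3 * m) = 3 ^ m"
    "max_part_prod (3 * m + 2) = 2 * 3 ^ m" "max_part_prod (3 * m + 4) = 4 * 3 ^ m"
    unfolding max_part_prod_def mod_div_3 by simp_all
qed

lemma lead_coeff_lim_simps:
  "lead_coeff_lim x 1 = x"
  "lead_coeff_lim x (3 * m) = (x / 3) ^ m / fact m"
  "lead_coeff_lim x (3 * m + 2) = x / 2 * (x / 3) ^ m / fact m"
  "lead_coeff_lim x (3 * m + 4) = (x / 4 + x\<^sup>2 / 8) * (x / 3) ^ m / fact m"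
proof -
  have "3 * m \<noteq> 1" by presburger
  then show "lead_coeff_lim x 1 = x"
    "lead_coeff_lim x (3 * m) = (x / 3) ^ m / fact m"
    "lead_coeff_lim x (3 * m + 2) = x / 2 * (x / 3) ^ m / fact m"
    "lead_coeff_lim x (3 * m + 4) = (x / 4 + x\<^sup>2 / 8) * (x / 3) ^ m / fact m"
    unfolding lead_coeff_lim_def mod_div_3 by simp_all
qed

text \<open>Peels off a common factor \<open>u\<close>, which turns later identities between limit
  coefficients into rational identities in \<open>x\<close>, \<open>k\<close> and
  \<open>u\<close>.\<close>

lemma power_over_fact_Suc: "y ^ Suc m / fact (Suc m) = y / real (Suc m) * (y ^ m / fact m :: real)"
  by simp

text \<open>Writing the class of 1 as \<open>3 * m + 4\<close> leaves \<open>m\<close> threes beside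
  the extra 4 or 2 + 2, and isolates the exceptional \<open>n = 1\<close>.\<close>

lemma residue_cases [case_names one zero two four]:
  fixes n :: nat
  obtains "n = 1" | m where "n = 3 * m" | m where "n = 3 * m + 2" | m where "n = 3 * m + 4"
proof -
  have "n = 1 \<or> n = 3 * (n div 3) \<or> n = 3 * (n div 3) + 2 \<or> n = 3 * (n div 3 - 1) + 4"
    by presburger
  then show ?thesis using that by blast
qed

lemma max_part_prod_pos: "max_part_prod n > 0"
  by (simp add: max_part_prod_def)

lemma lead_coeff_lim_pos: "x > 0 \<Longrightarrow> lead_coeff_lim x n > 0"
  by (simp add: lead_coeff_lim_def add_pos_pos)

section \<open>Optimal parts and the recursion of the limit coefficients\<close>

text \<open>Strictness in the first claim shows that a part 1 is wasted unless it is the only part;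
  the other claims are base cases for larger parts.\<close>

lemma max_part_prod_small_part:
  "j > 0 \<Longrightarrow> max_part_prod j < max_part_prod (1 + j)"
  "2 * max_part_prod j \<le> max_part_prod (2 + j)"
  "3 * max_part_prod j \<le> max_part_prod (3 + j)"
  "4 * max_part_prod j \<le> max_part_prod (4 + j)"
proof -
  have ex:
    "max_part_prod 2 = 2" "max_part_prod 3 = 3" "max_part_prod 4 = 4" "max_part_prod 5 = 6"
    by (simp_all add: max_part_prod_def)
  have *: "(j > 0 \<longrightarrow> max_part_prod j < max_part_prod (1 + j)) \<and>
    2 * max_part_prod j \<le> max_part_prod (2 + j) \<and>
    3 * max_part_prod j \<le> max_part_prod (3 + j) \<and>
    4 * max_part_prod j \<le> max_part_prod (4 + j)"
  proof (cases j rule: residue_cases)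
    case one
    have "1 + j = 2" "2 + j = 3" "3 + j = 4" "4 + j = 5" using one by auto
    then show ?thesis by (simp only: one ex max_part_prod_simps) simp
  next
    case (zero m)
    have e: "2 + j = 3 * m + 2" "3 + j = 3 * Suc m" "4 + j = 3 * m + 4" using zero by auto
    have "j > 0 \<longrightarrow> max_part_prod j < max_part_prod (1 + j)"
    proof
      assume "j > 0"
      then obtain k where k: "m = Suc k" using zero by (cases m) auto
      then have "1 + j = 3 * k + 4" using zero by auto
      then show "max_part_prod j < max_part_prod (1 + j)"
        unfolding zero by (simp only: max_part_prod_simps k) simp
    qed
    moreover have "2 * max_part_prod j \<le> max_part_prod (2 + j)"
      "3 * max_part_prod j \<le> max_part_prod (3 + j)" "4 * max_part_prod j \<le> max_part_prod (4 + j)"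
      unfolding e unfolding zero max_part_prod_simps by simp_all
    ultimately show ?thesis by blast
  next
    case (two m)
    have e: "1 + j = 3 * Suc m" "2 + j = 3 * m + 4" "3 + j = 3 * Suc m + 2" "4 + j = 3 * Suc (Suc m)"
      using two by auto
    show ?thesis unfolding e unfolding two max_part_prod_simps by simp
  next
    case (four m)
    have e: "1 + j = 3 * Suc m + 2" "2 + j = 3 * Suc (Suc m)" "3 + j = 3 * Suc m + 4"
      "4 + j = 3 * Suc (Suc m) + 2"
      using four by auto
    show ?thesis unfolding e unfolding four max_part_prod_simps by simp
  qed
  show "j > 0 \<Longrightarrow> max_part_prod j < max_part_prod (1 + j)"
    "2 * max_part_prod j \<le> max_part_prod (2 + j)"
    "3 * max_part_prod j \<le> max_part_prod (3 + j)"
    "4 * max_part_prod j \<le> max_part_prod (4 + j)" using * by auto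
qed

text \<open>For \<open>k \<ge> 5\<close> split off a 3, using \<open>k \<le> 3 * (k - 3)\<close>,
  and apply induction to \<open>k - 3\<close>. This bound keeps every term of the recursion for
  \<open>P\<close> within order \<open>A\<^sub>n^d\<close>.\<close>

lemma part_mult_max_part_prod_le: "k \<ge> 1 \<Longrightarrow> k * max_part_prod j \<le> max_part_prod (k + j)"
proof (induction k rule: less_induct)
  case (less k)
  consider "k = 1" | "k = 2" | "k = 3" | "k = 4" | "k \<ge> 5" using less.prems by linarith
  then show ?case
  proof cases
    case 1
    then show ?thesis using max_part_prod_small_part(1)[of j]
      by (cases "j = 0") (auto simp: max_part_prod_def)
  next
    case 5
    have "k \<le> 3 * (k - 3)" using 5 by linarith
    then have "k * max_part_prod j \<le> 3 * ((k - 3) * max_part_prod j)" by simp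
    also have "\<dots> \<le> 3 * max_part_prod (k - 3 + j)" using less.IH[of "k - 3"] 5 by simp
    also have "\<dots> \<le> max_part_prod (3 + (k - 3 + j))" by (rule max_part_prod_small_part)
    also have "3 + (k - 3 + j) = k + j" using 5 by simp
    finally show ?thesis .
  qed (use max_part_prod_small_part in auto)
qed

text \<open>A part \<open>k \<ge> 5\<close> is never optimal: splitting it into \<open>3\<close> and \<open>k - 3\<close> increases the product.\<close>

lemma part_mult_max_part_prod_less:
  assumes "k \<ge> 5"
  shows "k * max_part_prod j < max_part_prod (k + j)"
proof -
  have "k < 3 * (k - 3)" using assms by linarith
  then have "k * max_part_prod j < 3 * ((k - 3) * max_part_prod j)"
    using max_part_prod_pos[of j] by simp
  also have "\<dots> \<le> 3 * max_part_prod (k - 3 + j)"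
    using part_mult_max_part_prod_le[of "k - 3" j] assms by simp
  also have "\<dots> \<le> max_part_prod (3 + (k - 3 + j))" by (rule max_part_prod_small_part)
  also have "3 + (k - 3 + j) = k + j" using assms by simp
  finally show ?thesis .
qed

lemma optimal_part_sum:
  fixes f :: "nat \<Rightarrow> real"
  assumes "n \<ge> 5"
  shows "(\<Sum>k = 1..n. if k * max_part_prod (n - k) = max_part_prod n then f k else 0) =
    (\<Sum>k\<in>{2, 3, 4}. if k * max_part_prod (n - k) = max_part_prod n then f k else 0)"
proof (rule sum.mono_neutral_right)
  show "\<forall>k\<in>{1..n} - {2, 3, 4}. (if k * max_part_prod (n - k) = max_part_prod n then f k else 0) = 0"
  proof
    fix k assume k: "k \<in> {1..n} - {2, 3, 4}"
    have "k * max_part_prod (n - k) < max_part_prod n"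
    proof (cases "k = 1")
      case True
      then show ?thesis using max_part_prod_small_part(1)[of "n - 1"] assms by simp
    next
      case False
      then have "k \<ge> 5" using k by auto
      then show ?thesis using part_mult_max_part_prod_less[of k "n - k"] k by simp
    qed
    then show "(if k * max_part_prod (n - k) = max_part_prod n then f k else 0) = 0" by simp
  qed
qed (use assms in auto)

text \<open>This is the recursion for \<open>P\<close> divided by \<open>A\<^sub>n^d\<close> in the
  limit, where only optimal parts survive. For \<open>n \<ge> 5\<close> these are 3 if
  \<open>n\<close> is 0 mod 3, both 2 and 3 if it is 2, and all of 2, 3, 4 if it is 1.\<close>

lemma lead_coeff_lim_rec:
  assumes "n \<ge> 1"
  shows "x / real n * (\<Sum>k = 1..n. if k * max_part_prod (n - k) = max_part_prod n
      then lead_coeff_lim x (n - k) else 0) = lead_coeff_lim x n"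
proof (cases "n \<ge> 5")
  case False
  then consider "n = 1" | "n = 2" | "n = 3" | "n = 4" using assms by linarith
  then show ?thesis
  proof cases
    case 1
    then show ?thesis by (simp add: max_part_prod_def lead_coeff_lim_def)
  next
    case 2
    have "{1..2::nat} = {1, 2}" by auto
    then show ?thesis using 2 by (simp add: max_part_prod_def lead_coeff_lim_def)
  next
    case 3
    have "{1..3::nat} = {1, 2, 3}" by auto
    then show ?thesis using 3 by (simp add: max_part_prod_def lead_coeff_lim_def)
  next
    case 4
    have "{1..4::nat} = {1, 2, 3, 4}" by auto
    then show ?thesis using 4
      by (simp add: max_part_prod_def lead_coeff_lim_def field_simps power2_eq_square)
  qed
next
  case True
  note S = optimal_part_sum[OF True, of "\<lambda>k. lead_coeff_lim x (n - k)"]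
  show ?thesis
  proof (cases n rule: residue_cases)
    case one
    then show ?thesis using True by simp
  next
    case (zero m)
    define k where "k = m - 2"
    have k: "m = Suc (Suc k)" using True zero unfolding k_def by simp
    have e: "n - 2 = 3 * k + 4" "n - 3 = 3 * Suc k" "n - 4 = 3 * k + 2" using zero k by auto
    have A: "max_part_prod n = 9 * 3 ^ k" "max_part_prod (n - 2) = 4 * 3 ^ k"
      "max_part_prod (n - 3) = 3 * 3 ^ k" "max_part_prod (n - 4) = 2 * 3 ^ k"
      unfolding e unfolding zero k max_part_prod_simps by simp_all
    have T: "(\<Sum>k\<in>{2, 3, 4}. if k * max_part_prod (n - k) = max_part_prod n
        then lead_coeff_lim x (n - k) else 0) = lead_coeff_lim x (n - 3)"
      by (simp add: A)
    show ?thesis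
      unfolding S T e unfolding zero k lead_coeff_lim_simps power_over_fact_Suc[of _ "Suc k"] by simp
  next
    case (two m)
    then obtain k where k: "m = Suc k" using True by (cases m) auto
    have e: "n - 2 = 3 * Suc k" "n - 3 = 3 * k + 2" using two k by auto
    have A: "max_part_prod n = 6 * 3 ^ k" "max_part_prod (n - 2) = 3 * 3 ^ k"
      "max_part_prod (n - 3) = 2 * 3 ^ k"
      unfolding e unfolding two k max_part_prod_simps by simp_all
    \<comment> \<open>For \<open>n = 5\<close> the remainder is the exceptional index 1, giving 4
      against 6; otherwise the ratio is 16 : 18.\<close>
    have "4 * max_part_prod (n - 4) \<noteq> max_part_prod n"
    proof (cases k)
      case 0
      then show ?thesis using two k by (simp add: max_part_prod_def)
    next
      case (Suc l)
      then have l: "n - 4 = 3 * l + 4" using two k by simp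
      show ?thesis unfolding A l max_part_prod_simps Suc by simp
    qed
    then have T: "(\<Sum>k\<in>{2, 3, 4}. if k * max_part_prod (n - k) = max_part_prod n
        then lead_coeff_lim x (n - k) else 0) = lead_coeff_lim x (n - 2) + lead_coeff_lim x (n - 3)"
      by (simp add: A)
    define u where "u = (x / 3) ^ k / fact k"
    show ?thesis
      unfolding S T e unfolding two k lead_coeff_lim_simps times_divide_eq_right[symmetric]
        power_over_fact_Suc u_def[symmetric]
      by (simp add: divide_simps) (simp add: algebra_simps)
  next
    case (four m)
    then obtain k where k: "m = Suc k" using True by (cases m) auto
    have e: "n - 2 = 3 * Suc k + 2" "n - 3 = 3 * k + 4" "n - 4 = 3 * Suc k" using four k by auto
    have A: "max_part_prod n = 12 * 3 ^ k" "max_part_prod (n - 2) = 6 * 3 ^ k"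
      "max_part_prod (n - 3) = 4 * 3 ^ k" "max_part_prod (n - 4) = 3 * 3 ^ k"
      unfolding e unfolding four k max_part_prod_simps by simp_all
    have T: "(\<Sum>k\<in>{2, 3, 4}. if k * max_part_prod (n - k) = max_part_prod n
        then lead_coeff_lim x (n - k) else 0) =
        lead_coeff_lim x (n - 2) + lead_coeff_lim x (n - 3) + lead_coeff_lim x (n - 4)"
      by (simp add: A)
    define u where "u = (x / 3) ^ k / fact k"
    show ?thesis
      unfolding S T e unfolding four k lead_coeff_lim_simps times_divide_eq_right[symmetric]
        power_over_fact_Suc u_def[symmetric]
      by (simp add: divide_simps) (simp add: algebra_simps power2_eq_square)
  qed
qed

section \<open>Limits as d tends to infinity\<close>

lemma tendsto_ratio_power_indicator:
  fixes a b :: nat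
  assumes "a \<le> b" "b > 0"
  shows "(\<lambda>d. (real a / real b) ^ d) \<longlonglongrightarrow> (if a = b then 1 else 0)"
proof (cases "a = b")
  case False
  then have "(\<lambda>d. (real a / real b) ^ d) \<longlonglongrightarrow> 0" using assms by (intro LIMSEQ_realpow_zero) auto
  then show ?thesis using False by simp
qed (use assms in simp)

text \<open>Dividing the defining inequalities by \<open>k^d\<close> squeezes the quotient between 1
  and 1 plus a multiple of \<open>((k - 1) / k)^(d - 1)\<close>.\<close>

lemma double_seqs_ratio_tendsto:
  assumes "g \<in> double_seqs" "k \<ge> 1"
  shows "(\<lambda>d. g d k / real k ^ d) \<longlonglongrightarrow> 1"
proof (rule tendsto_sandwich)
  have g: "0 \<le> g d k - real k ^ d" "g d k - real k ^ d \<le> g 1 k * (real k - 1) ^ (d - 1)"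
    if "d \<ge> 1" for d using assms that unfolding double_seqs_def by auto
  show "\<forall>\<^sub>F d in sequentially. 1 \<le> g d k / real k ^ d"
    using eventually_ge_at_top[of 1] by eventually_elim (use g assms in \<open>auto simp: field_simps\<close>)
  let ?u = "\<lambda>d. 1 + g 1 k / real k * ((real k - 1) / real k) ^ (d - 1)"
  show "\<forall>\<^sub>F d in sequentially. g d k / real k ^ d \<le> ?u d"
    using eventually_ge_at_top[of 1]
  proof eventually_elim
    case (elim d)
    then obtain e where e: "d = Suc e" by (cases d) auto
    show ?case using g(2)[OF elim] assms unfolding e by (simp add: field_simps power_divide)
  qed
  have "(\<lambda>e. ((real k - 1) / real k) ^ e) \<longlonglongrightarrow> 0"
    using assms by (intro LIMSEQ_realpow_zero) auto
  then have "(\<lambda>d. ((real k - 1) / real k) ^ (d - 1)) \<longlonglongrightarrow> 0"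
    by (subst filterlim_sequentially_Suc[symmetric]) simp
  from tendsto_add[OF tendsto_const[of 1] tendsto_mult[OF tendsto_const[of "g 1 k / real k"] this]]
  show "?u \<longlonglongrightarrow> 1" by simp
qed simp

lemma P_rec: "n \<ge> 1 \<Longrightarrow> P h n x = x / real n * (\<Sum>k = 1..n. h k * P h (n - k) x)"
  by (cases n) simp_all

lemma P_asymptotics:
  assumes "g \<in> double_seqs"
  shows "(\<lambda>d. P (g d) n x / real (max_part_prod n) ^ d) \<longlonglongrightarrow> lead_coeff_lim x n"
proof (induction n rule: less_induct)
  case (less n)
  show ?case
  proof (cases "n = 0")
    case True
    then show ?thesis by (simp add: max_part_prod_def lead_coeff_lim_def)
  next
    case False
    let ?A = max_part_prod
    \<comment> \<open>A summand of the recursion over \<open>A\<^sub>n^d\<close>, factored so that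
      each factor converges; the last tends to 1 if \<open>k\<close> is optimal and to 0
      otherwise.\<close>
    let ?t = "\<lambda>k d. g d k / real k ^ d * (P (g d) (n - k) x / real (?A (n - k)) ^ d) *
      (real (k * ?A (n - k)) / real (?A n)) ^ d"
    have "(\<lambda>d. x / real n * (\<Sum>k = 1..n. ?t k d)) \<longlonglongrightarrow>
      x / real n * (\<Sum>k = 1..n. 1 * lead_coeff_lim x (n - k) * (if k * ?A (n - k) = ?A n then 1 else 0))"
    proof (intro tendsto_mult tendsto_sum tendsto_const)
      fix k assume k: "k \<in> {1..n}"
      show "(\<lambda>d. g d k / real k ^ d) \<longlonglongrightarrow> 1"
        using k by (intro double_seqs_ratio_tendsto[OF assms]) simp
      show "(\<lambda>d. P (g d) (n - k) x / real (?A (n - k)) ^ d) \<longlonglongrightarrow> lead_coeff_lim x (n - k)"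
        using k by (intro less.IH) simp
      show "(\<lambda>d. (real (k * ?A (n - k)) / real (?A n)) ^ d) \<longlonglongrightarrow> (if k * ?A (n - k) = ?A n then 1 else 0)"
        using part_mult_max_part_prod_le[of k "n - k"] k
        by (intro tendsto_ratio_power_indicator max_part_prod_pos) simp
    qed
    also have "(\<Sum>k = 1..n. 1 * lead_coeff_lim x (n - k) * (if k * ?A (n - k) = ?A n then 1 else 0)) =
      (\<Sum>k = 1..n. if k * ?A (n - k) = ?A n then lead_coeff_lim x (n - k) else 0)"
      by (intro sum.cong) auto
    also have "x / real n * \<dots> = lead_coeff_lim x n" using False by (intro lead_coeff_lim_rec) simp
    also have "(\<lambda>d. x / real n * (\<Sum>k = 1..n. ?t k d)) = (\<lambda>d. P (g d) n x / real (?A n) ^ d)"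
    proof
      fix d
      have "?t k d = g d k * P (g d) (n - k) x / real (?A n) ^ d" if "k \<in> {1..n}" for k
        using that max_part_prod_pos[of "n - k"] max_part_prod_pos[of n]
        by (simp add: power_divide power_mult_distrib)
      then have "(\<Sum>k = 1..n. ?t k d) = (\<Sum>k = 1..n. g d k * P (g d) (n - k) x) / real (?A n) ^ d"
        unfolding sum_divide_distrib by (intro sum.cong) auto
      then show "x / real n * (\<Sum>k = 1..n. ?t k d) = P (g d) n x / real (?A n) ^ d"
        using P_rec[of n "g d" x] False by simp
    qed
    finally show ?thesis .
  qed
qed

text \<open>With \<open>B\<close> the larger of the two products, a term of smaller order vanishes;
  in a tie both survive.\<close>

lemma turan_diff_asymptotics:
  assumes "g \<in> double_seqs" and B: "B > 0"
    "(max_part_prod n)\<^sup>2 \<le> B" "max_part_prod (n - 1) * max_part_prod (n + 1) \<le> B"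
  shows "(\<lambda>d. turan_diff (g d) n x / real B ^ d) \<longlonglongrightarrow>
     (lead_coeff_lim x n)\<^sup>2 * (if (max_part_prod n)\<^sup>2 = B then 1 else 0) -
     lead_coeff_lim x (n - 1) * lead_coeff_lim x (n + 1) *
       (if max_part_prod (n - 1) * max_part_prod (n + 1) = B then 1 else 0)"
proof -
  let ?A = max_part_prod
  let ?p = "\<lambda>n d. P (g d) n x / real (?A n) ^ d"
  have "(\<lambda>d. (?p n d)\<^sup>2 * (real ((?A n)\<^sup>2) / real B) ^ d -
      ?p (n - 1) d * ?p (n + 1) d * (real (?A (n - 1) * ?A (n + 1)) / real B) ^ d) \<longlonglongrightarrow>
     (lead_coeff_lim x n)\<^sup>2 * (if (?A n)\<^sup>2 = B then 1 else 0) -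
     lead_coeff_lim x (n - 1) * lead_coeff_lim x (n + 1) * (if ?A (n - 1) * ?A (n + 1) = B then 1 else 0)"
    by (intro tendsto_diff tendsto_mult tendsto_power P_asymptotics tendsto_ratio_power_indicator assms)
  also have "(\<lambda>d. (?p n d)\<^sup>2 * (real ((?A n)\<^sup>2) / real B) ^ d -
      ?p (n - 1) d * ?p (n + 1) d * (real (?A (n - 1) * ?A (n + 1)) / real B) ^ d) =
      (\<lambda>d. turan_diff (g d) n x / real B ^ d)"
  proof
    fix d
    have "(?p n d)\<^sup>2 * (real ((?A n)\<^sup>2) / real B) ^ d = (P (g d) n x)\<^sup>2 / real B ^ d"
      using max_part_prod_pos[of n]
      by (simp add: power_divide power_mult_distrib flip: power_mult) (simp add: mult.commute)
    moreover have "?p (n - 1) d * ?p (n + 1) d * (real (?A (n - 1) * ?A (n + 1)) / real B) ^ d =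
        P (g d) (n - 1) x * P (g d) (n + 1) x / real B ^ d"
      using max_part_prod_pos[of "n - 1"] max_part_prod_pos[of "n + 1"]
      by (simp add: power_divide power_mult_distrib)
    ultimately show "(?p n d)\<^sup>2 * (real ((?A n)\<^sup>2) / real B) ^ d -
      ?p (n - 1) d * ?p (n + 1) d * (real (?A (n - 1) * ?A (n + 1)) / real B) ^ d =
      turan_diff (g d) n x / real B ^ d"
      by (simp only: turan_diff_def diff_divide_distrib)
  qed
  finally show ?thesis .
qed

section \<open>The sign of the Turan difference for large d\<close>

lemma turan_almost_all_if_lim_pos:
  assumes "(\<lambda>d. turan_diff (g d) n x / real B ^ d) \<longlonglongrightarrow> l" "l > 0"
  shows "turan_almost_all g n x"
proof -
  have "\<forall>\<^sub>F d in sequentially. turan_diff (g d) n x / real B ^ d > 0"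
    using assms by (rule order_tendstoD)
  then have "\<forall>\<^sub>F d in sequentially. turan_holds g n x d"
  proof eventually_elim
    case (elim d)
    \<comment> \<open>A zero denominator would make the quotient 0, so strict positivity already
      excludes it.\<close>
    have "real B ^ d \<ge> 0" by simp
    with elim show ?case unfolding turan_holds_def by (auto simp: zero_less_divide_iff)
  qed
  then obtain N where "\<And>d. d \<ge> N \<Longrightarrow> turan_holds g n x d"
    by (auto simp: eventually_sequentially)
  then have "{d. d \<ge> 1 \<and> \<not> turan_holds g n x d} \<subseteq> {..<N}" by (auto simp: not_le[symmetric])
  then show ?thesis unfolding turan_almost_all_def by (rule finite_subset) simp
qed

lemma not_turan_almost_all_if_lim_neg:
  assumes "(\<lambda>d. turan_diff (g d) n x / real B ^ d) \<longlonglongrightarrow> l" "l < 0"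
  shows "\<not> turan_almost_all g n x"
proof -
  have "\<forall>\<^sub>F d in sequentially. turan_diff (g d) n x / real B ^ d < 0"
    using assms by (rule order_tendstoD)
  then have "\<forall>\<^sub>F d in sequentially. \<not> turan_holds g n x d"
  proof eventually_elim
    case (elim d)
    have "real B ^ d \<ge> 0" by simp
    with elim show ?case unfolding turan_holds_def by (auto simp: divide_less_0_iff)
  qed
  then obtain N where "\<And>d. d \<ge> N \<Longrightarrow> \<not> turan_holds g n x d"
    by (auto simp: eventually_sequentially)
  then have "{max 1 N..} \<subseteq> {d. d \<ge> 1 \<and> \<not> turan_holds g n x d}" by auto
  then show ?thesis unfolding turan_almost_all_def using infinite_Ici finite_subset by blast
qed

text \<open>Here \<open>P\<^sub>n(0) = 0\<close>, so the difference is nonnegative whatever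
  \<open>n\<close> is mod 3. Hence the equivalence with \<open>3 dvd n\<close> can only be claimed
  for \<open>x > 0\<close>.\<close>

lemma turan_almost_all_zero: "n \<ge> 1 \<Longrightarrow> turan_almost_all g n 0"
  by (simp add: turan_almost_all_def turan_holds_def turan_diff_def P_rec)

lemma turan_almost_all_mod_0:
  assumes "g \<in> double_seqs" "x > 0" "m > 0"
  shows "turan_almost_all g (3 * m) x"
proof -
  obtain k where k: "m = Suc k" using assms by (cases m) auto
  have e: "3 * m - 1 = 3 * k + 2" "3 * m + 1 = 3 * k + 4" using k by auto
  have A: "max_part_prod (3 * m - 1) * max_part_prod (3 * m + 1) < (max_part_prod (3 * m))\<^sup>2"
    unfolding e unfolding max_part_prod_simps k by (simp add: power2_eq_square)
  have "(\<lambda>d. turan_diff (g d) (3 * m) x / real ((max_part_prod (3 * m))\<^sup>2) ^ d)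
      \<longlonglongrightarrow> (lead_coeff_lim x (3 * m))\<^sup>2"
    using turan_diff_asymptotics[OF assms(1), of "(max_part_prod (3 * m))\<^sup>2" "3 * m" x] A
      max_part_prod_pos[of "3 * m"] by simp
  moreover have "(lead_coeff_lim x (3 * m))\<^sup>2 > 0"
    using lead_coeff_lim_pos[OF assms(2), of "3 * m"] by simp
  ultimately show ?thesis by (rule turan_almost_all_if_lim_pos)
qed

lemma not_turan_almost_all_mod_1:
  assumes "g \<in> double_seqs" "x > 0"
  shows "\<not> turan_almost_all g (3 * m + 4) x"
proof -
  let ?n = "3 * m + 4"
  let ?B = "max_part_prod (?n - 1) * max_part_prod (?n + 1)"
  have e: "?n - 1 = 3 * Suc m" "?n + 1 = 3 * Suc m + 2" by auto
  have A: "(max_part_prod ?n)\<^sup>2 < ?B"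
    unfolding e unfolding max_part_prod_simps by (simp add: power2_eq_square)
  have "(\<lambda>d. turan_diff (g d) ?n x / real ?B ^ d)
      \<longlonglongrightarrow> - (lead_coeff_lim x (?n - 1) * lead_coeff_lim x (?n + 1))"
    using turan_diff_asymptotics[OF assms(1), of ?B ?n x] A
      max_part_prod_pos[of "?n - 1"] max_part_prod_pos[of "?n + 1"] by simp
  moreover have "- (lead_coeff_lim x (?n - 1) * lead_coeff_lim x (?n + 1)) < 0"
    using lead_coeff_lim_pos[OF assms(2)] by simp
  ultimately show ?thesis by (rule not_turan_almost_all_if_lim_neg)
qed

lemma not_turan_almost_all_mod_2:
  assumes "g \<in> double_seqs" "x > 0" "m > 0" "x * (real m + 2) < 2 * real m"
  shows "\<not> turan_almost_all g (3 * m + 2) x"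
proof -
  let ?n = "3 * m + 2"
  let ?B = "(max_part_prod ?n)\<^sup>2"
  obtain k where k: "m = Suc k" using assms by (cases m) auto
  have e: "?n - 1 = 3 * k + 4" "?n + 1 = 3 * Suc (Suc k)" using k by auto
  have A: "max_part_prod (?n - 1) * max_part_prod (?n + 1) = ?B"
    unfolding e unfolding max_part_prod_simps k by (simp add: power2_eq_square)
  let ?l = "(lead_coeff_lim x ?n)\<^sup>2 - lead_coeff_lim x (?n - 1) * lead_coeff_lim x (?n + 1)"
  have "(\<lambda>d. turan_diff (g d) ?n x / real ?B ^ d) \<longlonglongrightarrow> ?l"
    using turan_diff_asymptotics[OF assms(1), of ?B ?n x] A max_part_prod_pos[of ?n] by simp
  moreover have "?l < 0"
  proof -
    \<comment> \<open>In terms of \<open>u\<close> the coefficients at \<open>n\<close>,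
      \<open>n - 1\<close>, \<open>n + 1\<close> are \<open>x\<^sup>2 u / (6 m)\<close>,
      \<open>x (x + 2) u / 8\<close> and \<open>x\<^sup>2 u / (9 m (m + 1))\<close>.\<close>
    define u where "u = (x / 3) ^ k / fact k"
    have "u > 0" unfolding u_def using assms(2) by simp
    have "?l = (x * u)\<^sup>2 * x * (x * (real m + 2) - 2 * real m) / (72 * (real m)\<^sup>2 * (real m + 1))"
      unfolding e unfolding k lead_coeff_lim_simps times_divide_eq_right[symmetric]
        power_over_fact_Suc u_def[symmetric]
      by (simp add: divide_simps) (simp add: algebra_simps power2_eq_square power4_eq_xxxx)
    also have "(x * u)\<^sup>2 * x * (x * (real m + 2) - 2 * real m) / (72 * (real m)\<^sup>2 * (real m + 1)) < 0"
      using assms \<open>u > 0\<close> by (intro divide_neg_pos mult_pos_neg) auto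
    finally show ?thesis .
  qed
  ultimately show ?thesis by (rule not_turan_almost_all_if_lim_neg)
qed

theorem theorem1:
  fixes g :: "nat \<Rightarrow> nat \<Rightarrow> real" and n :: nat
  assumes "g \<in> double_seqs" and "n \<ge> 6"
  shows "(\<forall>x::real. 0 < x \<and> x < 2 - 12 / (real n + 4) \<longrightarrow>
            (turan_almost_all g n x \<longleftrightarrow> 3 dvd n)) \<and>
         (n mod 3 \<noteq> 2 \<longrightarrow>
            (\<forall>x::real. 0 < x \<longrightarrow> (turan_almost_all g n x \<longleftrightarrow> 3 dvd n))) \<and>
         turan_almost_all g n 0"
proof -
  have "turan_almost_all g n x \<longleftrightarrow> 3 dvd n"
    if x: "x > 0" and n: "x < 2 - 12 / (real n + 4) \<or> n mod 3 \<noteq> 2" for x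
  proof (cases n rule: residue_cases)
    case one
    then show ?thesis using assms by simp
  next
    case (zero m)
    then show ?thesis using turan_almost_all_mod_0[OF assms(1) x, of m] assms(2) by simp
  next
    case (two m)
    then have m: "m > 0" using assms(2) by (cases m) auto
    have "x < 2 - 12 / (real n + 4)" using n unfolding two mod_div_3 by simp
    \<comment> \<open>Since \<open>n + 4 = 3 (m + 2)\<close>, the bound on \<open>x\<close> equals
      \<open>2 - 4 / (m + 2)\<close>.\<close>
    then have "x * (real m + 2) < 2 * real m" unfolding two by (simp add: field_simps)
    moreover have "\<not> 3 dvd n" unfolding two by presburger
    ultimately show ?thesis
      using not_turan_almost_all_mod_2[OF assms(1) x m] unfolding two by simp
  next
    case (four m)
    moreover have "\<not> 3 dvd n" unfolding four by presburger
    ultimately show ?thesis using not_turan_almost_all_mod_1[OF assms(1) x, of m] by simp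
  qed
  then show ?thesis using turan_almost_all_zero[of n g] assms(2) by auto
qed

end
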